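(* Let $\mathbf G$ be an Erdős–Rényi random graph on nodes $[n]$ in which each edge is present independently with probability $p\ge 1.5\ln(n)/n$, and let $s=1$, $t=n$. Then any (possibly randomized) algorithm that outputs an $s$-$t$ path in $\mathbf G$ using node-incidence queries either makes $\Omega(1/(p\sqrt n))$ node-incidence queries, or outputs a valid $s$-$t$ path with probability at most $o(1)+p$ (probability over the random graph and the algorithm's randomness).
   Context: Query model: the nodes are labeled by $[n]$; a node-incidence query specifies a node $i\in[n]$ and returns the set of all edges incident to $i$. The algorithm chooses each query (possibly randomly) as a function of the answers to previous queries, and finally outputs a sequence of nodes from $s$ to $t$; the output is valid if every consecutive pair is an edge of the graph. *)

theory Defs
  imports "HOL-Probability.Probability" "HOL-Probability.Product_PMF"
begin

text \<open>A graph on the nodes \<open>{1..n}\<close> is represented by its set of edges.\<close>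

type_synonym edge_set = "nat set set"

definition all_edges :: "nat \<Rightarrow> edge_set" where
  "all_edges n = {e. e \<subseteq> {1..n} \<and> card e = 2}"

definition erdos_renyi :: "nat \<Rightarrow> real \<Rightarrow> edge_set pmf" where
  "erdos_renyi n p =
     map_pmf (\<lambda>f. {e \<in> all_edges n. f e})
       (Pi_pmf (all_edges n) False (\<lambda>_. bernoulli_pmf p))"

definition incident_edges :: "edge_set \<Rightarrow> nat \<Rightarrow> edge_set" where
  "incident_edges G i = {e \<in> G. i \<in> e}"

definition valid_path :: "edge_set \<Rightarrow> nat \<Rightarrow> nat \<Rightarrow> nat list \<Rightarrow> bool" where
  "valid_path G s t xs \<longleftrightarrow>
     xs \<noteq> [] \<and> hd xs = s \<and> last xs = t \<and> successively (\<lambda>u v. {u, v} \<in> G) xs"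

text \<open>
  \<open>Output xs\<close> halts with the node sequence \<open>xs\<close>; \<open>Query i k\<close> queries the node \<open>i\<close> and, on
  answer \<open>a\<close>, continues with a step drawn at random from \<open>k a\<close>.  A randomized algorithm is a
  distribution on its first step, of type \<open>step pmf\<close>.  The random choices made so far are
  remembered in the continuation, so this covers both a private random seed drawn at the
  start and fresh randomness at every query.  Countable supports lose no generality, since
  there are only countably many queries and outputs to choose from, and each choice may be
  drawn afresh from its conditional distribution given the queries and answers so far.
  Querying a number outside \<open>{1..n}\<close> is possible, but is counted and answered by the empty set.
\<close>

datatype step = Output "nat list" | Query nat "edge_set \<Rightarrow> step pmf"

text \<open>
  The joint distribution of the number of queries made (repetitions included) and the output.
  The equation for \<open>Query\<close> is in the form required for recursion through \<open>pmf\<close>; see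
  \<open>exec_Query\<close> for its monadic form.
\<close>

primrec exec :: "edge_set \<Rightarrow> step \<Rightarrow> (nat \<times> nat list) pmf" where
  "exec G (Output xs) = return_pmf (0, xs)"
| "exec G (Query i k) =
     map_pmf (\<lambda>(m, xs). (Suc m, xs))
       (join_pmf (map_pmf (exec G) (k (incident_edges G i))))"

lemma exec_Query:
  "exec G (Query i k) =
     bind_pmf (k (incident_edges G i)) (\<lambda>A. map_pmf (\<lambda>(m, xs). (Suc m, xs)) (exec G A))"
  by (simp add: join_eq_bind_pmf bind_map_pmf map_bind_pmf)

definition run :: "step pmf \<Rightarrow> edge_set \<Rightarrow> (nat \<times> nat list) pmf" where
  "run A G = bind_pmf A (exec G)"

definition makes_at_most :: "nat \<Rightarrow> step pmf \<Rightarrow> nat \<Rightarrow> bool" where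
  "makes_at_most n A q \<longleftrightarrow>
     (\<forall>G. G \<subseteq> all_edges n \<longrightarrow> (\<forall>(m, xs) \<in> set_pmf (run A G). m \<le> q))"

definition success_prob :: "nat \<Rightarrow> real \<Rightarrow> step pmf \<Rightarrow> real" where
  "success_prob n p A =
     measure_pmf.prob
       (bind_pmf (erdos_renyi n p) (\<lambda>G. map_pmf (\<lambda>(m, xs). (G, xs)) (run A G)))
       {(G, xs). valid_path G 1 n xs}"

end

theory Submission
  imports Defs
begin

text \<open>
  Reveal the edges lazily.  Call a node seen if it is \<open>1\<close>, \<open>n\<close>, a queried node or a neighbour of
  one.  As long as no query reveals a fresh edge from the queried node to a seen node, every
  query only attaches unseen nodes to a single component of the revealed graph, so \<open>1\<close> and \<open>n\<close>
  stay in different components, and any output path must use an edge that is still undetermined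
  and hence present with probability at most \<open>p\<close>.  A query is bad with probability at most \<open>p\<close>
  times the number of seen nodes, and this number grows by at most \<open>1 + p n\<close> per query in
  expectation.  The bad events thus have total probability at most
  \<open>2 q p + q\<^sup>2 p (1 + p n)\<close>, which is small if \<open>q p \<surd>n\<close> is.
\<close>

section \<open>Random subsets\<close>

text \<open>The ground set is a parameter because the edges still undetermined after some queries
  again form such a random set.\<close>

definition random_subset :: "'a set \<Rightarrow> real \<Rightarrow> 'a set pmf" where
  "random_subset U p = map_pmf (\<lambda>f. {e \<in> U. f e}) (Pi_pmf U False (\<lambda>_. bernoulli_pmf p))"

lemma erdos_renyi_eq_random_subset: "erdos_renyi n p = random_subset (all_edges n) p"
  by (simp add: erdos_renyi_def random_subset_def)

lemma set_random_subset: "set_pmf (random_subset U p) \<subseteq> Pow U"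
  by (auto simp: random_subset_def)

text \<open>Deferred decisions: the edges settled by a query may be drawn first, and the remaining
  ones stay independent of them.\<close>

lemma random_subset_Un:
  assumes "finite U" "finite V" "U \<inter> V = {}"
  shows "random_subset (U \<union> V) p =
    bind_pmf (random_subset U p) (\<lambda>X. map_pmf (\<lambda>Y. X \<union> Y) (random_subset V p))"
proof -
  have eq: "{e \<in> U \<union> V. if e \<in> U then f e else g e} = {e \<in> U. f e} \<union> {e \<in> V. g e}" for f g
    using assms(3) by auto
  show ?thesis
    unfolding random_subset_def Pi_pmf_union[OF assms]
    unfolding map_pmf_def pair_pmf_def
    by (simp only: bind_assoc_pmf bind_return_pmf prod.case eq)
qed

lemma prob_mem_random_subset_le:
  assumes "finite U" "0 \<le> p" "p \<le> 1"
  shows "measure_pmf.prob (random_subset U p) {X. e \<in> X} \<le> p"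
proof (cases "e \<in> U")
  case True
  have "measure_pmf.prob (random_subset U p) {X. e \<in> X} =
    measure_pmf.prob (map_pmf (\<lambda>f. f e) (Pi_pmf U False (\<lambda>_. bernoulli_pmf p))) {True}"
    using True by (simp add: random_subset_def vimage_def)
  also have "\<dots> = p"
    using True assms by (subst Pi_pmf_component) (simp_all add: measure_pmf_single)
  finally show ?thesis by simp
next
  case False
  have "{f. e \<in> {e \<in> U. f e}} = {}" using False by auto
  then show ?thesis using assms(2) by (simp add: random_subset_def vimage_def False)
qed

lemma expectation_mem_random_subset_le:
  assumes "finite U" "0 \<le> p" "p \<le> 1"
  shows "measure_pmf.expectation (random_subset U p) (\<lambda>X. of_bool (e \<in> X)) \<le> p"
proof -
  have "(\<lambda>X. of_bool (e \<in> X) :: real) = indicator {X. e \<in> X}"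
    by (auto simp: indicator_def)
  then show ?thesis using prob_mem_random_subset_le[OF assms, of e] by simp
qed

lemma finite_set_random_subset: "finite U \<Longrightarrow> finite (set_pmf (random_subset U p))"
  by (rule finite_subset[OF set_random_subset]) simp

section \<open>Winning probabilities\<close>

lemma finite_all_edges: "finite (all_edges n)"
  by (rule finite_subset[of _ "Pow {1..n}"]) (auto simp: all_edges_def)

lemma pmf_bind_le:
  assumes "\<And>x. x \<in> set_pmf M \<Longrightarrow> pmf (f x) y \<le> b"
  shows "pmf (bind_pmf M f) y \<le> b"
proof -
  have "pmf (bind_pmf M f) y = measure_pmf.expectation M (\<lambda>x. pmf (f x) y)"
    by (rule pmf_bind)
  also have "\<dots> \<le> b"
    using assms by (intro measure_pmf.integral_le_const)
      (auto simp: AE_measure_pmf_iff pmf_le_1 intro!: measure_pmf.integrable_const_bound[where B=1])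
  finally show ?thesis .
qed

definition wins :: "nat \<Rightarrow> edge_set \<Rightarrow> step \<Rightarrow> bool pmf" where
  "wins n G A = map_pmf (\<lambda>(m, xs). valid_path G 1 n xs) (exec G A)"

lemma wins_Output: "wins n G (Output xs) = return_pmf (valid_path G 1 n xs)"
  by (simp add: wins_def)

lemma wins_Query: "wins n G (Query i k) = bind_pmf (k (incident_edges G i)) (wins n G)"
  unfolding exec_Query wins_def[abs_def]
  by (simp add: map_bind_pmf map_pmf_comp case_prod_unfold)

text \<open>Stated for one graph, since in the induction the query bound is available only for
  graphs that extend the revealed edges by undetermined ones.\<close>

definition within_budget :: "edge_set \<Rightarrow> step \<Rightarrow> nat \<Rightarrow> bool" where
  "within_budget G A q \<longleftrightarrow> (\<forall>(m, xs) \<in> set_pmf (exec G A). m \<le> q)"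

lemma within_budget_QueryD:
  assumes "within_budget G (Query i k) q"
  obtains q' where "q = Suc q'" "\<And>B. B \<in> set_pmf (k (incident_edges G i)) \<Longrightarrow> within_budget G B q'"
proof -
  have le: "Suc m \<le> q"
    if "B \<in> set_pmf (k (incident_edges G i))" "(m, xs) \<in> set_pmf (exec G B)" for B m xs
    using assms that unfolding within_budget_def exec_Query by fastforce
  \<comment> \<open>Supports are nonempty, so some run exists; its first query forces
    \<open>q\<close> to be positive.\<close>
  obtain B where B: "B \<in> set_pmf (k (incident_edges G i))"
    using set_pmf_not_empty by fast
  obtain m xs where "(m, xs) \<in> set_pmf (exec G B)"
    using set_pmf_not_empty[of "exec G B"] by auto
  from le[OF B this] obtain q' where q: "q = Suc q'" by (cases q) auto
  show ?thesis
  proof (rule that[OF q])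
    show "within_budget G B q'" if "B \<in> set_pmf (k (incident_edges G i))" for B
      using le[OF that] unfolding within_budget_def q by auto
  qed
qed

text \<open>The choice of the first step is independent of the graph and can be drawn before it; it
  then suffices to bound each fixed first step.\<close>

lemma success_prob_eq_wins:
  "success_prob n p A =
    pmf (bind_pmf A (\<lambda>B. bind_pmf (random_subset (all_edges n) p) (\<lambda>G. wins n G B))) True"
proof -
  let ?M = "bind_pmf (erdos_renyi n p) (\<lambda>G. map_pmf (\<lambda>(m, xs). (G, xs)) (run A G))"
  have "bind_pmf A (\<lambda>B. bind_pmf (random_subset (all_edges n) p) (\<lambda>G. wins n G B)) =
    map_pmf (\<lambda>(G, xs). valid_path G 1 n xs) ?M"
    by (subst bind_commute_pmf)
      (simp add: erdos_renyi_eq_random_subset run_def wins_def[abs_def] map_bind_pmf map_pmf_comp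
        case_prod_unfold)
  then show ?thesis
    by (simp add: success_prob_def pmf_map vimage_def case_prod_unfold)
qed

section \<open>Separation of the endpoints\<close>

text \<open>The pair is the first one that leaves \<open>C\<close>. Since \<open>P\<close> is
  quantified only after it, the pair depends on \<open>xs\<close> alone, and the same edge serves
  for every random graph.\<close>

lemma crossing_pair:
  assumes "xs \<noteq> []" "hd xs \<in> C" "last xs \<notin> C"
  obtains u v where "u \<in> C" "v \<notin> C" "\<And>P. successively P xs \<Longrightarrow> P u v"
proof -
  have "\<exists>u v. u \<in> C \<and> v \<notin> C \<and> (\<forall>P. successively P xs \<longrightarrow> P u v)"
    using assms
  proof (induction xs)
    case (Cons x xs)
    show ?case
    proof (cases xs)
      case Nil
      with Cons.prems show ?thesis by simp
    next
      case (Cons y ys)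
      show ?thesis
      proof (cases "y \<in> C")
        case True
        then obtain u v where "u \<in> C" "v \<notin> C" "\<And>P. successively P xs \<Longrightarrow> P u v"
          using Cons Cons.IH Cons.prems by fastforce
        then show ?thesis unfolding Cons successively.simps by blast
      next
        case False
        then show ?thesis using Cons Cons.prems by auto
      qed
    qed
  qed simp
  then obtain u v where uv: "u \<in> C" "v \<notin> C" "\<forall>P. successively P xs \<longrightarrow> P u v"
    by (elim exE conjE)
  show ?thesis by (rule that[OF uv(1,2)]) (rule uv(3)[rule_format])
qed

text \<open>
  \<open>R\<close> is the set of revealed edges, \<open>S\<close> contains the seen nodes, and \<open>C\<close> is a union of
  components of the revealed graph.
\<close>

definition separated :: "nat \<Rightarrow> edge_set \<Rightarrow> nat set \<Rightarrow> nat set \<Rightarrow> bool" where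
  "separated n R S C \<longleftrightarrow> finite S \<and> 1 \<in> C \<and> n \<notin> C \<and> n \<in> S \<and> C \<subseteq> S \<and> \<Union>R \<subseteq> S \<and>
     (\<forall>e\<in>R. e \<subseteq> C \<or> e \<inter> C = {})"

text \<open>A valid output must leave \<open>C\<close> somewhere. No revealed edge does, so one
  fixed edge has to occur among the undetermined ones.\<close>

lemma wins_Output_le:
  assumes "finite U" "0 \<le> p" "p \<le> 1" and sep: "separated n R S C"
  shows "pmf (bind_pmf (random_subset U p) (\<lambda>Y. wins n (R \<union> Y) (Output xs))) True \<le> p"
proof (cases "xs \<noteq> [] \<and> hd xs = 1 \<and> last xs = n")
  case True
  then obtain u v where uv: "u \<in> C" "v \<notin> C" "\<And>P. successively P xs \<Longrightarrow> P u v"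
    using crossing_pair[of xs C] sep by (auto simp: separated_def)
  from uv(1,2) sep have "{u, v} \<notin> R" by (auto simp: separated_def)
  then have sub: "valid_path (R \<union> Y) 1 n xs \<Longrightarrow> {u, v} \<in> Y" for Y
    using uv(3)[of "\<lambda>u v. {u, v} \<in> R \<union> Y"] by (auto simp: valid_path_def)
  have "pmf (bind_pmf (random_subset U p) (\<lambda>Y. wins n (R \<union> Y) (Output xs))) True =
    measure_pmf.prob (random_subset U p) {Y. valid_path (R \<union> Y) 1 n xs}"
    by (simp add: wins_Output map_pmf_def[symmetric] pmf_map vimage_def)
  also have "\<dots> \<le> measure_pmf.prob (random_subset U p) {Y. {u, v} \<in> Y}"
    using sub by (intro measure_pmf.finite_measure_mono) auto
  also have "\<dots> \<le> p" using assms(1-3) by (rule prob_mem_random_subset_le)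
  finally show ?thesis .
next
  case False
  then have "valid_path G 1 n xs = False" for G by (auto simp: valid_path_def)
  then show ?thesis using assms(2) by (simp add: wins_Output)
qed

text \<open>Each new edge joins \<open>i\<close> to an unseen node, so it cannot link two
  components: if \<open>i\<close> lies in \<open>C\<close>, the new nodes join \<open>C\<close>;
  otherwise \<open>C\<close> is kept.\<close>

lemma separated_query:
  assumes sep: "separated n R S C"
    and X: "X \<subseteq> {e \<in> all_edges n. i \<in> e}"
    and good: "\<And>v. v \<in> S \<Longrightarrow> {i, v} \<notin> X"
  obtains C' where "separated n (R \<union> X) (S \<union> {i} \<union> \<Union>X) C'"
proof -
  have fin: "finite (\<Union>X)"
    by (rule finite_subset[of _ "{1..n}"]) (use X in \<open>auto simp: all_edges_def\<close>)
  have edge: "\<exists>v. e = {i, v} \<and> v \<notin> S" if e: "e \<in> X" for e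
  proof -
    have "card e = 2" "i \<in> e" using e X by (auto simp: all_edges_def)
    then obtain v where v: "e = {i, v}"
      unfolding card_2_iff by auto
    with good e show ?thesis by auto
  qed
  show ?thesis
  proof (cases "i \<in> C")
    case True
    have sub: "\<Union>X \<inter> S \<subseteq> {i}" using edge by blast
    \<comment> \<open>As \<open>n\<close> is seen, by \<open>sub\<close> it could enter the enlarged
      component only as \<open>i\<close> itself.\<close>
    have "n \<noteq> i" using True sep by (auto simp: separated_def)
    moreover have "e \<subseteq> C \<union> \<Union>X \<or> e \<inter> (C \<union> \<Union>X) = {}" if "e \<in> R" for e
    proof (cases "e \<subseteq> C")
      case False
      then have "e \<inter> C = {}" "e \<subseteq> S" using sep that by (auto simp: separated_def)
      with sub True show ?thesis by blast
    qed blast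
    ultimately have "separated n (R \<union> X) (S \<union> {i} \<union> \<Union>X) (C \<union> \<Union>X)"
      using sep fin sub by (auto simp: separated_def)
    then show ?thesis by (rule that)
  next
    case False
    have "e \<inter> C = {}" if "e \<in> X" for e
      using edge[OF that] False sep by (auto simp: separated_def)
    then have "separated n (R \<union> X) (S \<union> {i} \<union> \<Union>X) C"
      using sep fin by (auto simp: separated_def)
    then show ?thesis by (rule that)
  qed
qed

section \<open>Counting incident edges and seen nodes\<close>

lemma incident_edge_cases:
  assumes "e \<in> all_edges n" "i \<in> e"
  obtains v where "v \<in> {1..n}" "e = {i, v}"
proof -
  from assms(1) obtain x y where xy: "e = {x, y}" "x \<in> {1..n}" "y \<in> {1..n}"
    unfolding all_edges_def card_2_iff by auto
  show ?thesis
  proof (cases "i = x")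
    case True
    then show ?thesis using that xy by blast
  next
    case False
    then show ?thesis using that[of x] xy assms(2) by (simp add: insert_commute)
  qed
qed

lemma card_incident_le: "card {e \<in> all_edges n. i \<in> e} \<le> n"
proof -
  have "{e \<in> all_edges n. i \<in> e} \<subseteq> (\<lambda>v. {i, v}) ` {1..n}"
    by (auto elim!: incident_edge_cases)
  then show ?thesis using surj_card_le[of "{1..n}" _ "\<lambda>v. {i, v}"] by simp
qed

text \<open>Every edge of \<open>X\<close> contains \<open>i\<close> and so adds at most one further
  node, selected by \<open>f\<close>.\<close>

lemma card_seen_le:
  assumes "finite S" and X: "X \<subseteq> {e \<in> all_edges n. i \<in> e}"
  shows "card (S \<union> {i} \<union> \<Union>X) \<le> card S + 1 + card X"
proof -
  have finX: "finite X" using X finite_all_edges[of n] by (auto intro: finite_subset)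
  define f where "f e = (SOME v. e = {i, v})" for e :: "nat set"
  have "e = {i, f e}" if "e \<in> X" for e
    unfolding f_def by (rule someI_ex) (use that X in \<open>auto elim: incident_edge_cases\<close>)
  then have "S \<union> {i} \<union> \<Union>X \<subseteq> S \<union> {i} \<union> f ` X" by blast
  then have "card (S \<union> {i} \<union> \<Union>X) \<le> card (S \<union> {i} \<union> f ` X)"
    using finX assms(1) by (intro card_mono) auto
  also have "\<dots> \<le> card S + card {i} + card (f ` X)"
    using card_Un_le[of "S \<union> {i}" "f ` X"] card_Un_le[of S "{i}"] by linarith
  also have "\<dots> \<le> card S + 1 + card X" using card_image_le[OF finX, of f] by simp
  finally show ?thesis .
qed

text \<open>\<open>U\<close> holds the undetermined edges. The term with \<open>card S\<close> pays
  for queries that hit nodes already seen; the quadratic term pays for hits on nodes that become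
  seen later.\<close>

lemma wins_le:
  fixes p :: real
  assumes p: "0 \<le> p" "p \<le> 1"
    and "U \<subseteq> all_edges n" "separated n R S C"
    and "\<And>Y. Y \<subseteq> U \<Longrightarrow> within_budget (R \<union> Y) A q"
  shows "pmf (bind_pmf (random_subset U p) (\<lambda>Y. wins n (R \<union> Y) A)) True \<le>
    p + q * p * card S + (real q)\<^sup>2 * p * (1 + p * n)"
  using assms(3-)
proof (induction A arbitrary: U R S C q)
  case (Output xs)
  have "finite U" using Output.prems(1) finite_all_edges finite_subset by blast
  then have "pmf (bind_pmf (random_subset U p) (\<lambda>Y. wins n (R \<union> Y) (Output xs))) True \<le> p"
    using p Output.prems(2) by (rule wins_Output_le)
  moreover have "0 \<le> q * p * card S + (real q)\<^sup>2 * p * (1 + p * n)" using p by simp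
  ultimately show ?case by linarith
next
  case (Query i k)
  have finU: "finite U" using Query.prems(1) finite_all_edges finite_subset by blast
  \<comment> \<open>The query settles \<open>I\<close> and leaves \<open>V\<close>
    undetermined.\<close>
  define I where "I = {e \<in> U. i \<in> e}"
  define V where "V = {e \<in> U. i \<notin> e}"
  have U: "U = I \<union> V" "I \<inter> V = {}" and fin: "finite I" "finite V"
    using finU by (auto simp: I_def V_def)
  have I: "I \<subseteq> {e \<in> all_edges n. i \<in> e}" using Query.prems(1) by (auto simp: I_def)
  define ans where "ans X = incident_edges (R \<union> X) i" for X
  \<comment> \<open>The answer does not depend on \<open>V\<close>, so the next step of the
    algorithm can be drawn before the edges in \<open>V\<close>.\<close>
  have ans: "incident_edges (R \<union> X \<union> Y) i = ans X" if "Y \<subseteq> V" for X Y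
    using that by (auto simp: ans_def incident_edges_def V_def)
  obtain r where q: "q = Suc r"
    using Query.prems(3)[of "{}"] by (auto elim: within_budget_QueryD)
  define W where
    "W X = bind_pmf (k (ans X)) (\<lambda>B. bind_pmf (random_subset V p) (\<lambda>Y. wins n (R \<union> X \<union> Y) B))"
    for X
  have "bind_pmf (random_subset U p) (\<lambda>Y. wins n (R \<union> Y) (Query i k)) =
    bind_pmf (random_subset I p) (\<lambda>X. bind_pmf (random_subset V p)
      (\<lambda>Y. wins n (R \<union> X \<union> Y) (Query i k)))"
    unfolding U(1) random_subset_Un[OF fin U(2)]
    by (simp add: bind_assoc_pmf bind_map_pmf Un_assoc)
  also have "\<dots> = bind_pmf (random_subset I p) W"
  proof (rule bind_pmf_cong[OF refl])
    fix X
    have "bind_pmf (random_subset V p) (\<lambda>Y. wins n (R \<union> X \<union> Y) (Query i k)) =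
      bind_pmf (random_subset V p) (\<lambda>Y. bind_pmf (k (ans X)) (wins n (R \<union> X \<union> Y)))"
      using set_random_subset[of V p] by (intro bind_pmf_cong) (auto simp: wins_Query ans)
    also have "\<dots> = W X" unfolding W_def by (rule bind_commute_pmf)
    finally show "bind_pmf (random_subset V p) (\<lambda>Y. wins n (R \<union> X \<union> Y) (Query i k)) = W X" .
  qed
  finally have "pmf (bind_pmf (random_subset U p) (\<lambda>Y. wins n (R \<union> Y) (Query i k))) True =
    measure_pmf.expectation (random_subset I p) (\<lambda>X. pmf (W X) True)"
    by (simp add: pmf_bind)
  \<comment> \<open>The first sum is at least 1 if the query hits a seen node (union bound). The
    second equals \<open>card X\<close>, the growth of the seen set apart from \<open>i\<close>,
    weighted as in the induction hypothesis for \<open>r\<close> queries. Both are linear in edge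
    indicators, whose expectations are at most \<open>p\<close>.\<close>
  also have "\<dots> \<le> measure_pmf.expectation (random_subset I p)
    (\<lambda>X. (\<Sum>v\<in>S. of_bool ({i, v} \<in> X)) + r * p * (\<Sum>e\<in>I. of_bool (e \<in> X)) +
      (p + r * p * (real (card S) + 1) + (real r)\<^sup>2 * p * (1 + p * n)))"
  proof (intro integral_mono_AE integrable_measure_pmf_finite finite_set_random_subset fin AE_pmfI)
    fix X assume "X \<in> set_pmf (random_subset I p)"
    then have XI: "X \<subseteq> I" using set_random_subset by blast
    show "pmf (W X) True \<le> (\<Sum>v\<in>S. of_bool ({i, v} \<in> X)) + r * p * (\<Sum>e\<in>I. of_bool (e \<in> X)) +
      (p + r * p * (real (card S) + 1) + (real r)\<^sup>2 * p * (1 + p * n))"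
    proof (cases "\<exists>v\<in>S. {i, v} \<in> X")
      case True
      have finS: "finite S" using Query.prems(2) by (simp add: separated_def)
      from True obtain v where v: "v \<in> S" "{i, v} \<in> X" by blast
      have "(1::real) \<le> (\<Sum>v\<in>S. of_bool ({i, v} \<in> X))"
        using member_le_sum[of v S "\<lambda>v. of_bool ({i, v} \<in> X) :: real"] v finS by simp
      moreover have "pmf (W X) True \<le> 1" by (rule pmf_le_1)
      moreover have "0 \<le> r * p * (\<Sum>e\<in>I. of_bool (e \<in> X))"
        using p by (intro mult_nonneg_nonneg sum_nonneg) auto
      moreover have "0 \<le> p + r * p * (real (card S) + 1) + (real r)\<^sup>2 * p * (1 + p * n)"
        using p by simp
      ultimately show ?thesis by linarith
    next
      case False
      have XE: "X \<subseteq> {e \<in> all_edges n. i \<in> e}" using XI I by blast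
      obtain C' where sep: "separated n (R \<union> X) (S \<union> {i} \<union> \<Union>X) C'"
        using separated_query[OF Query.prems(2) XE] False by blast
      have budget: "within_budget (R \<union> X \<union> Y) B r" if "B \<in> set_pmf (k (ans X))" "Y \<subseteq> V" for B Y
      proof -
        have "within_budget (R \<union> X \<union> Y) (Query i k) q"
          using Query.prems(3)[of "X \<union> Y"] XI that(2) U(1) by (auto simp: Un_assoc)
        then show ?thesis
          using that ans[OF that(2)] q by (auto elim: within_budget_QueryD)
      qed
      have "pmf (W X) True \<le> p + r * p * card (S \<union> {i} \<union> \<Union>X) + (real r)\<^sup>2 * p * (1 + p * n)"
        unfolding W_def
      proof (rule pmf_bind_le)
        fix B assume B: "B \<in> set_pmf (k (ans X))"
        show "pmf (bind_pmf (random_subset V p) (\<lambda>Y. wins n (R \<union> X \<union> Y) B)) True \<le>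
          p + r * p * card (S \<union> {i} \<union> \<Union>X) + (real r)\<^sup>2 * p * (1 + p * n)"
          using Query.prems(1) budget[OF B] by (intro Query.IH[OF _ B _ sep]) (auto simp: V_def)
      qed
      also have "\<dots> \<le> p + r * p * (real (card S) + 1 + real (card X)) + (real r)\<^sup>2 * p * (1 + p * n)"
      proof -
        have "card (S \<union> {i} \<union> \<Union>X) \<le> card S + 1 + card X"
          using Query.prems(2) XE by (intro card_seen_le) (auto simp: separated_def)
        then have "real (card (S \<union> {i} \<union> \<Union>X)) \<le> real (card S) + 1 + real (card X)"
          by linarith
        then have "r * p * real (card (S \<union> {i} \<union> \<Union>X)) \<le> r * p * (real (card S) + 1 + real (card X))"
          using p by (intro mult_left_mono) auto
        then show ?thesis by simp
      qed
      also have "real (card X) = (\<Sum>e\<in>I. of_bool (e \<in> X))"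
        using XI fin(1) by (simp add: of_bool_def sum.If_cases Int_absorb1)
      finally have "pmf (W X) True \<le> p + r * p * (real (card S) + 1 + (\<Sum>e\<in>I. of_bool (e \<in> X)))
        + (real r)\<^sup>2 * p * (1 + p * n)" by simp
      moreover have "0 \<le> (\<Sum>v\<in>S. of_bool ({i, v} \<in> X) :: real)" by (intro sum_nonneg) auto
      ultimately show ?thesis by (simp add: algebra_simps)
    qed
  qed
  also have "\<dots> = (\<Sum>v\<in>S. measure_pmf.expectation (random_subset I p) (\<lambda>X. of_bool ({i, v} \<in> X)))
      + r * p * (\<Sum>e\<in>I. measure_pmf.expectation (random_subset I p) (\<lambda>X. of_bool (e \<in> X)))
      + (p + r * p * (real (card S) + 1) + (real r)\<^sup>2 * p * (1 + p * n))"
    using fin(1) by (simp add: integrable_measure_pmf_finite finite_set_random_subset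
        del: sum_of_bool_eq)
  also have "\<dots> \<le> (\<Sum>v\<in>S. p) + r * p * (\<Sum>e\<in>I. p)
      + (p + r * p * (real (card S) + 1) + (real r)\<^sup>2 * p * (1 + p * n))"
    using p fin(1)
    by (intro add_mono order_refl sum_mono mult_left_mono expectation_mem_random_subset_le) auto
  also have "\<dots> \<le> p * card S + r * p * (p * n) + (p + r * p * (real (card S) + 1) + (real r)\<^sup>2 * p * (1 + p * n))"
  proof -
    have "card I \<le> n"
      using card_mono[OF _ I] card_incident_le[of n i] finite_all_edges[of n] by simp
    then have "(\<Sum>e\<in>I. p) \<le> p * n" using p by (simp add: mult.commute[of _ p] mult_left_mono)
    then have "r * p * (\<Sum>e\<in>I. p) \<le> r * p * (p * n)" using p by (intro mult_left_mono) auto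
    then show ?thesis by (simp add: mult.commute)
  qed
  \<comment> \<open>The expected growth, at most \<open>1 + p * n\<close>, enters with weight
    \<open>r * p\<close>; this raises the coefficient \<open>r^2\<close> to \<open>r^2 + r\<close>,
    which is below \<open>(r + 1)^2\<close>.\<close>
  also have "\<dots> = p + q * p * card S + ((real r)\<^sup>2 + r) * p * (1 + p * n)"
    unfolding q by (simp add: algebra_simps power2_eq_square)
  also have "\<dots> \<le> p + q * p * card S + (real q)\<^sup>2 * p * (1 + p * n)"
  proof -
    have "(real r)\<^sup>2 + r \<le> (real q)\<^sup>2" unfolding q by (simp add: power2_eq_square algebra_simps)
    then have "((real r)\<^sup>2 + r) * (p * (1 + p * n)) \<le> (real q)\<^sup>2 * (p * (1 + p * n))"
      using p by (intro mult_right_mono) auto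
    then show ?thesis by (simp add: mult.assoc)
  qed
  finally show ?case .
qed

section \<open>The bound from the start and the choice of the constant\<close>

lemma success_prob_le:
  assumes "2 \<le> n" "0 \<le> p" "p \<le> 1" "makes_at_most n A q"
  shows "success_prob n p A \<le> p + 2 * real q * p + (real q)\<^sup>2 * p * (1 + p * n)"
proof -
  \<comment> \<open>Before any query only the two endpoints are seen, and they are distinct as
    \<open>2 \<le> n\<close>.\<close>
  have sep: "separated n {} {1, n} {1}" using assms(1) by (auto simp: separated_def)
  have "success_prob n p A \<le> p + q * p * card {1, n} + (real q)\<^sup>2 * p * (1 + p * n)"
    unfolding success_prob_eq_wins
  proof (rule pmf_bind_le)
    fix B assume "B \<in> set_pmf A"
    then have "within_budget ({} \<union> Y) B q" if "Y \<subseteq> all_edges n" for Y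
      using assms(4) that by (auto simp: makes_at_most_def within_budget_def run_def)
    from wins_le[OF assms(2,3) order_refl sep this]
    show "pmf (bind_pmf (random_subset (all_edges n) p) (\<lambda>G. wins n G B)) True \<le>
      p + q * p * card {1, n} + (real q)\<^sup>2 * p * (1 + p * n)" by simp
  qed
  also have "card {1, n} = 2" using assms(1) by simp
  finally show ?thesis by (simp add: algebra_simps)
qed

theorem theorem4:
  fixes \<delta> :: real
  assumes "\<delta> > 0"
  shows "\<exists>c::real. c > 0 \<and>
    (\<forall>\<^sub>F n::nat in sequentially. \<forall>(p::real) (A::step pmf) (q::nat).
       1.5 * ln (real n) / real n \<le> p \<and> p \<le> 1 \<and> makes_at_most n A q \<longrightarrow>
         real q \<ge> c / (p * sqrt (real n)) \<or> success_prob n p A \<le> \<delta> + p)"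
proof (intro exI conjI)
  \<comment> \<open>The error terms will total at most \<open>4 * t\<close> for some
    \<open>t < c\<close>: the 4 brings this below \<open>\<delta>\<close>, and the minimum with 1
    gives \<open>t^2 \<le> t\<close>.\<close>
  define c where "c = min 1 \<delta> / 4"
  show c: "c > 0" using assms by (simp add: c_def)
  show "\<forall>\<^sub>F n::nat in sequentially. \<forall>(p::real) (A::step pmf) (q::nat).
       1.5 * ln (real n) / real n \<le> p \<and> p \<le> 1 \<and> makes_at_most n A q \<longrightarrow>
         real q \<ge> c / (p * sqrt (real n)) \<or> success_prob n p A \<le> \<delta> + p"
  proof (intro eventually_sequentiallyI[of 3] allI impI disjCI)
    fix n :: nat and p :: real and A q
    assume n: "3 \<le> n" and *: "1.5 * ln (real n) / real n \<le> p \<and> p \<le> 1 \<and> makes_at_most n A q"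
      and less: "\<not> success_prob n p A \<le> \<delta> + p"
    \<comment> \<open>The threshold 3 exceeds e, which yields \<open>p * n \<ge> 1\<close>.\<close>
    have "1 \<le> ln (real n)" using n exp_le by (subst ln_ge_iff) auto
    then have "1 \<le> 1.5 * ln (real n)" by simp
    also have "\<dots> \<le> p * n" using * n by (simp add: divide_le_eq)
    finally have pn: "1 \<le> p * n" .
    then have "0 < p * n" by linarith
    then have p: "0 < p" by (simp add: zero_less_mult_iff)
    \<comment> \<open>The number of queries in units of \<open>1 / (p * sqrt n)\<close>; its square
      is the dominant error \<open>q^2 * p * (p * n)\<close>.\<close>
    define t where "t = q * p * sqrt n"
    show "real q \<ge> c / (p * sqrt (real n))"
    proof (rule ccontr)
      assume "\<not> ?thesis"
      then have tc: "t < c" using p n by (simp add: t_def field_simps)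
      have t0: "0 \<le> t" using p by (simp add: t_def)
      have "q * p * 1 \<le> t" unfolding t_def using p n by (intro mult_left_mono) auto
      then have 1: "2 * real q * p \<le> 2 * t" by simp
      have "(real q)\<^sup>2 * p * (1 + p * n) \<le> (real q)\<^sup>2 * p * (p * n + p * n)"
        using pn p by (intro mult_left_mono) auto
      also have "\<dots> = 2 * t\<^sup>2" by (simp add: t_def power_mult_distrib power2_eq_square)
      also have "\<dots> \<le> 2 * t"
        using t0 tc by (simp add: c_def power2_eq_square mult_left_le)
      finally have 2: "(real q)\<^sup>2 * p * (1 + p * n) \<le> 2 * t" .
      have "success_prob n p A \<le> p + 2 * real q * p + (real q)\<^sup>2 * p * (1 + p * n)"
        using n p * by (intro success_prob_le) auto
      with 1 2 tc have "success_prob n p A \<le> p + 4 * c" by simp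
      then show False using less by (simp add: c_def)
    qed
  qed
qed

end
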